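(* Let $f:\mathbb{Z}^n\to\mathbb{R}\cup\{+\infty\}$ be a DDM-convex function whose effective domain is nonempty and bounded, and let $K_\infty=\max\{\|x-y\|_\infty\mid x,y\in\operatorname{dom} f\}$. Then the scaling algorithm, started from any $x\in\operatorname{dom} f$, finds a minimizer of $f$ in $O(n\log_2K_\infty)$ calls of the 1-neighborhood minimization oracle; that is, its output is a minimizer of $f$, and there is an absolute constant $C$ (independent of $n$, $f$ and the initial point) such that the number of oracle calls is at most $C\,n\log_2K_\infty$ whenever $K_\infty\ge2$.
   Context: $\operatorname{dom} f=\{x\in\mathbb{Z}^n\mid f(x)<+\infty\}$; $n\ge1$. For $x,y\in\mathbb{Z}^n$, the vector $\mu(x,y)\in\mathbb{Z}^n$ is defined componentwise by $\mu(x,y)_i=\lceil (x_i+y_i)/2\rceil$ if $x_i\ge y_i$, and $\mu(x,y)_i=\lfloor (x_i+y_i)/2\rfloor$ if $x_i<y_i$. A function $f:\mathbb{Z}^n\to\mathbb{R}\cup\{+\infty\}$ is called DDM-convex if $f(x)+f(y)\ge f(\mu(x,y))+f(\mu(y,x))$ for all $x,y\in\mathbb{Z}^n$. For a function $h:\mathbb{Z}^n\to\mathbb{R}\cup\{+\infty\}$, a 1-neighborhood minimization oracle returns, for any $y\in\operatorname{dom} h$, some point minimizing $h$ over $N_1(y)=\{z\in\mathbb{Z}^n\mid\|z-y\|_\infty\le1\}$. The 1-neighborhood steepest descent algorithm for $h$ from a starting point $y^{(0)}\in\operatorname{dom} h$ does the following for $k=1,2,\dots$: it finds (by one oracle call)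 $y^{(k)}$ minimizing $h$ in $N_1(y^{(k-1)})$; if $h(y^{(k)})=h(y^{(k-1)})$ it outputs $y^{(k-1)}$ and stops, otherwise it continues with $k+1$. The scaling algorithm for $f$: S0: Let $x\in\operatorname{dom} f$ and $\alpha:=2^{\lceil\log_2(K_\infty+1)\rceil}$. S1: Find a vector $y\in\mathbb{Z}^n$ that minimizes $f^\alpha(y)=f(x+\alpha y)$ subject to $\|y\|_\infty\le n$, by the 1-neighborhood steepest descent algorithm (applied, from the starting point $y^{(0)}=\mathbf{0}$, to the function equal to $f^\alpha$ on $\{y\mid\|y\|_\infty\le n\}$ and $+\infty$ elsewhere), and set $x:=x+\alpha y$. S2: If $\alpha=1$, then stop and output $x$. S3: Set $\alpha:=\alpha/2$ and go to S1. *)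

theory Defs
  imports Complex_Main "HOL-Library.Extended_Real" "Jordan_Normal_Form.Matrix"
begin

text \<open>
  \<open>\<int>\<^sup>n\<close> is \<^term>\<open>carrier_vec n :: int vec set\<close>. A function \<open>\<int>\<^sup>n \<rightarrow> \<real> \<union> {+\<infinity>}\<close> is an
  \<^typ>\<open>ereal\<close>-valued function on \<^typ>\<open>int vec\<close> that is never \<open>-\<infinity>\<close> on the carrier; its values
  off the carrier are irrelevant.
\<close>

definition real_or_infty :: "nat \<Rightarrow> (int vec \<Rightarrow> ereal) \<Rightarrow> bool" where
  "real_or_infty n f \<longleftrightarrow> (\<forall>x\<in>carrier_vec n. f x \<noteq> -\<infinity>)"

definition edom :: "nat \<Rightarrow> (int vec \<Rightarrow> ereal) \<Rightarrow> int vec set" where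
  "edom n f = {x \<in> carrier_vec n. f x < \<infinity>}"

text \<open>Only meaningful in positive dimension, where the maximum is over a nonempty set.\<close>

definition norm_inf :: "int vec \<Rightarrow> int" where
  "norm_inf x = Max ((\<lambda>i. \<bar>x $ i\<bar>) ` {..<dim_vec x})"

definition \<mu> :: "int vec \<Rightarrow> int vec \<Rightarrow> int vec" where
  "\<mu> x y = vec (dim_vec x) (\<lambda>i.
     if x $ i \<ge> y $ i then \<lceil>real_of_int (x $ i + y $ i) / 2\<rceil>
     else \<lfloor>real_of_int (x $ i + y $ i) / 2\<rfloor>)"

definition DDM_convex :: "nat \<Rightarrow> (int vec \<Rightarrow> ereal) \<Rightarrow> bool" where
  "DDM_convex n f \<longleftrightarrow>
     (\<forall>x\<in>carrier_vec n. \<forall>y\<in>carrier_vec n. f x + f y \<ge> f (\<mu> x y) + f (\<mu> y x))"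

definition bounded_inf :: "int vec set \<Rightarrow> bool" where
  "bounded_inf S \<longleftrightarrow> (\<exists>B. \<forall>x\<in>S. norm_inf x \<le> B)"

text \<open>The maximum is over a finite nonempty set when the effective domain is nonempty and bounded.\<close>

definition K_inf :: "nat \<Rightarrow> (int vec \<Rightarrow> ereal) \<Rightarrow> int" where
  "K_inf n f = Max {norm_inf (x - y) | x y. x \<in> edom n f \<and> y \<in> edom n f}"

definition N1 :: "nat \<Rightarrow> int vec \<Rightarrow> int vec set" where
  "N1 n y = {z \<in> carrier_vec n. norm_inf (z - y) \<le> 1}"

text \<open>
  \<open>z\<close> is a possible answer of the 1-neighborhood minimization oracle for \<open>h\<close> to the query \<open>y\<close>.
  The oracle is nondeterministic: repeated queries may be answered differently.
\<close>

definition oracle_answer :: "nat \<Rightarrow> (int vec \<Rightarrow> ereal) \<Rightarrow> int vec \<Rightarrow> int vec \<Rightarrow> bool" where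
  "oracle_answer n h y z \<longleftrightarrow> y \<in> edom n h \<and> is_arg_min h (\<lambda>z. z \<in> N1 n y) z"

text \<open>
  Steepest descent for \<open>h\<close>. The state \<open>Search y\<close> holds the current point, \<open>Found y\<close> the
  output. Each transition makes exactly one oracle call.
\<close>

datatype descent_state = Search "int vec" | Found "int vec"

inductive descent_step ::
    "nat \<Rightarrow> (int vec \<Rightarrow> ereal) \<Rightarrow> descent_state \<Rightarrow> descent_state \<Rightarrow> bool"
  for n :: nat and h :: "int vec \<Rightarrow> ereal" where
  move: "oracle_answer n h y z \<Longrightarrow> h z \<noteq> h y \<Longrightarrow> descent_step n h (Search y) (Search z)"
| halt: "oracle_answer n h y z \<Longrightarrow> h z = h y \<Longrightarrow> descent_step n h (Search y) (Found y)"

definition scaled_box :: "nat \<Rightarrow> (int vec \<Rightarrow> ereal) \<Rightarrow> int vec \<Rightarrow> int \<Rightarrow> int vec \<Rightarrow> ereal" where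
  "scaled_box n f x \<alpha> y = (if norm_inf y \<le> int n then f (x + \<alpha> \<cdot>\<^sub>v y) else \<infinity>)"

text \<open>
  \<open>Phase x \<alpha> d c\<close>: step S1 is being executed with the current \<open>x\<close> and \<open>\<alpha>\<close>, the steepest descent
  subroutine is in state \<open>d\<close>, and \<open>c\<close> oracle calls have been made since the start of the whole
  algorithm. \<open>Stopped x c\<close>: the algorithm has stopped with output \<open>x\<close> after \<open>c\<close> oracle calls.
  Since \<open>\<alpha>\<close> is a power of two, \<open>\<alpha> div 2\<close> is exact whenever \<open>\<alpha> \<noteq> 1\<close>.
\<close>

datatype scaling_state =
    Phase "int vec" int descent_state nat
  | Stopped "int vec" nat

inductive scaling_step ::
    "nat \<Rightarrow> (int vec \<Rightarrow> ereal) \<Rightarrow> scaling_state \<Rightarrow> scaling_state \<Rightarrow> bool"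
  for n :: nat and f :: "int vec \<Rightarrow> ereal" where
  descend: "descent_step n (scaled_box n f x \<alpha>) d d' \<Longrightarrow>
    scaling_step n f (Phase x \<alpha> d c) (Phase x \<alpha> d' (Suc c))"
| stop: "\<alpha> = 1 \<Longrightarrow>
    scaling_step n f (Phase x \<alpha> (Found y) c) (Stopped (x + \<alpha> \<cdot>\<^sub>v y) c)"
| rescale: "\<alpha> \<noteq> 1 \<Longrightarrow>
    scaling_step n f (Phase x \<alpha> (Found y) c) (Phase (x + \<alpha> \<cdot>\<^sub>v y) (\<alpha> div 2) (Search (0\<^sub>v n)) c)"

definition scaling_init :: "nat \<Rightarrow> (int vec \<Rightarrow> ereal) \<Rightarrow> int vec \<Rightarrow> scaling_state" where
  "scaling_init n f x =
     Phase x (2 ^ nat \<lceil>log 2 (real_of_int (K_inf n f + 1))\<rceil>) (Search (0\<^sub>v n)) 0"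

end

theory Submission
  imports Defs
begin

text \<open>
  The algorithm works because a minimizer at scale \<open>2\<alpha>\<close> is already near a minimizer at scale
  \<open>\<alpha>\<close>, and because steepest descent advances by a full unit of distance with every move.

  Everything about scales rests on the parallelogram inequality (\<open>parallelogram_inequality\<close>). On the
  way from \<open>x\<close> to \<open>y\<close>, let level \<open>k\<close> be the step that moves by one unit every coordinate in which
  \<open>x\<close> and \<open>y\<close> differ by at least \<open>k\<close>. If \<open>p\<close> is reached from \<open>x\<close> by any subset of the levels, then
  \<open>f p + f (x + y - p) \<le> f x + f y\<close>. Midpoint convexity is the case of every other level; applied to
  points that differ by two levels only, it says that \<open>f\<close> is supermodular as a function of the set of
  levels, from which the general case follows (\<open>supermodular_of_halving\<close>).

  Taking the levels congruent to \<open>3\<close> or \<open>0\<close> modulo \<open>4\<close> shows that \<open>z \<mapsto> f (2 z)\<close> is again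
  DDM-convex, hence so is \<open>f\<close> at every scale \<open>2\<^sup>j\<close>. Taking two consecutive levels \<open>k, k + 1\<close> such that
  no coordinate has absolute value \<open>k\<close> gives proximity (\<open>proximity_two\<close>): the step is twice an
  integer vector \<open>z\<close>, so if the origin minimizes \<open>g\<close> over even vectors, then \<open>g (w - 2 z) \<le> g w\<close>.
  Such a \<open>k \<le> n\<close> exists by counting as long as \<open>w\<close> has a coordinate beyond \<open>n\<close>; therefore the box
  \<open>\<parallel>y\<parallel> \<le> n\<close> searched in each phase contains a minimizer over the whole lattice of that scale.

  Steepest descent needs midpoints only. Since \<open>\<mu> y w\<close> rounds towards \<open>y\<close>, it lies in the ball of
  radius \<open>k\<close> about the origin whenever \<open>y\<close> does and \<open>w\<close> is at distance at most \<open>k + 1\<close>. Hence if \<open>y\<close>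
  is minimal in the ball of radius \<open>k\<close>, its best neighbour is minimal in the ball of radius \<open>k + 1\<close>
  (\<open>minimizer_on_larger_box\<close>). After \<open>n\<close> moves the box is exhausted, so a phase makes at most \<open>n + 1\<close>
  calls; there are \<open>\<lceil>log\<^sub>2 (K + 1)\<rceil> + 1\<close> phases, where \<open>K\<close> is the diameter of the effective domain.
\<close>

section \<open>A supermodular inequality from halving\<close>

text \<open>
  Every other element of \<open>D\<close> in increasing order, starting with the second. An initial segment of \<open>D\<close>
  with \<open>c\<close> elements thus contains \<open>\<lfloor>c / 2\<rfloor>\<close> of them, which is how \<^const>\<open>\<mu>\<close> rounds the number of
  steps away from its first argument.
\<close>

definition even_ranked :: "nat set \<Rightarrow> nat set" where
  "even_ranked D = {k \<in> D. even (card {j \<in> D. j \<le> k})}"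

lemma card_even_ranked_le:
  assumes "finite D"
  shows "card {k \<in> even_ranked D. k \<le> t} = card {k \<in> D. k \<le> t} div 2"
proof (induction t)
  case 0
  have "{k \<in> D. k \<le> 0} = (if 0 \<in> D then {0} else {})" by auto
  moreover have "{k \<in> even_ranked D. k \<le> 0} = {}"
  proof -
    have "odd (card {j \<in> D. j \<le> 0})" if "0 \<in> D"
    proof -
      have "{j \<in> D. j \<le> 0} = {0}" using that by auto
      then show ?thesis by (metis card.empty card.insert empty_iff finite.emptyI odd_one One_nat_def)
    qed
    then show ?thesis unfolding even_ranked_def by fastforce
  qed
  ultimately show ?case by simp
next
  case (Suc t)
  let ?A = "{k \<in> D. k \<le> t}"
  have fin: "finite ?A" "finite {k \<in> even_ranked D. k \<le> t}"
    using assms by (auto simp: even_ranked_def)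
  show ?case
  proof (cases "Suc t \<in> D")
    case False
    then have "{k \<in> D. k \<le> Suc t} = ?A"
      "{k \<in> even_ranked D. k \<le> Suc t} = {k \<in> even_ranked D. k \<le> t}"
      by (auto simp: even_ranked_def le_Suc_eq)
    then show ?thesis using Suc by simp
  next
    case True
    then have D: "{k \<in> D. k \<le> Suc t} = insert (Suc t) ?A" by auto
    then have c: "card {k \<in> D. k \<le> Suc t} = Suc (card ?A)" using fin by simp
    have "{k \<in> even_ranked D. k \<le> Suc t} =
        (if even (Suc (card ?A)) then insert (Suc t) {k \<in> even_ranked D. k \<le> t}
         else {k \<in> even_ranked D. k \<le> t})"
      using True c by (auto simp: even_ranked_def le_Suc_eq)
    then have "card {k \<in> even_ranked D. k \<le> Suc t} =
        (if even (Suc (card ?A)) then Suc (card {k \<in> even_ranked D. k \<le> t})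
         else card {k \<in> even_ranked D. k \<le> t})"
      using fin by simp
    then show ?thesis using Suc c by (auto elim!: evenE oddE)
  qed
qed

lemma card_even_ranked:
  assumes "finite D"
  shows "card (even_ranked D) = card D div 2"
proof -
  obtain t where "\<forall>k\<in>D. k \<le> t" using assms finite_nat_set_iff_bounded_le by blast
  then have "{k \<in> even_ranked D. k \<le> t} = even_ranked D" "{k \<in> D. k \<le> t} = D"
    by (auto simp: even_ranked_def)
  then show ?thesis using card_even_ranked_le[OF assms, of t] by simp
qed

lemma even_ranked_subset: "even_ranked D \<subseteq> D"
  by (auto simp: even_ranked_def)

lemma ereal_add_le_cancel_lower:
  fixes a b v w :: ereal
  assumes "b + v \<le> a + w" "a \<le> b" "\<bar>a\<bar> \<noteq> \<infinity>"
  shows "v \<le> w"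
proof -
  have "a + v \<le> a + w" using assms(1) add_right_mono[OF assms(2), of v] by (rule order_trans[rotated])
  then show ?thesis using assms(3) by (auto simp: ereal_add_le_add_iff)
qed

text \<open>
  The induction on the size of the interval \<open>[J, K]\<close> needs two passes, because an inequality can be
  subtracted only when the terms involved are finite. Halving puts two complementary sets \<open>J \<union> E\<close> and
  \<open>J \<union> O'\<close> into the domain of \<open>F\<close>; smaller intervals between them and the ends then place the whole
  interval in the domain. After that, the claim for \<open>M\<close> is the sum of the claims for two smaller
  intervals that share the two terms to be cancelled.
\<close>

lemma supermodular_of_halving:
  fixes F :: "nat set \<Rightarrow> ereal"
  assumes halve: "\<And>J K. finite K \<Longrightarrow> J \<subseteq> K \<Longrightarrow>
      F (J \<union> even_ranked (K - J)) + F (K - even_ranked (K - J)) \<le> F J + F K"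
    and ninf: "\<And>J. F J \<noteq> -\<infinity>"
  shows "finite K \<Longrightarrow> J \<subseteq> M \<Longrightarrow> M \<subseteq> K \<Longrightarrow> F M + F (J \<union> (K - M)) \<le> F J + F K"
proof (induction "card (K - J)" arbitrary: J K M rule: less_induct)
  case less
  have finK: "finite K" and JK: "J \<subseteq> K" using less.prems by auto
  have finD: "finite (K - J)" using finK by simp
  have smaller: "card (K' - J') < card (K - J)"
    if "J \<subseteq> J'" "K' \<subseteq> K" "J' \<subseteq> K'" "J' \<noteq> J \<or> K' \<noteq> K" for J' K'
  proof (rule psubset_card_mono[OF finD])
    show "K' - J' \<subset> K - J" using that JK by blast
  qed
  have IH: "F M' + F (J' \<union> (K' - M')) \<le> F J' + F K'"
    if "J \<subseteq> J'" "K' \<subseteq> K" "J' \<noteq> J \<or> K' \<noteq> K" "J' \<subseteq> M'" "M' \<subseteq> K'" for J' K' M'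
  proof -
    have "J' \<subseteq> K'" using that by blast
    then have "card (K' - J') < card (K - J)" using smaller that by blast
    moreover have "finite K'" using that(2) finK finite_subset by blast
    ultimately show ?thesis using less.hyps that(4,5) by blast
  qed
  have IHfin: "F M' < \<infinity>"
    if "J \<subseteq> J'" "K' \<subseteq> K" "J' \<noteq> J \<or> K' \<noteq> K" "J' \<subseteq> M'" "M' \<subseteq> K'" "F J' < \<infinity>" "F K' < \<infinity>"
    for J' K' M'
  proof -
    have "F M' + F (J' \<union> (K' - M')) < \<infinity>"
      by (rule le_less_trans[OF IH[OF that(1-5)]]) (use that(6,7) in simp)
    then show ?thesis by simp
  qed
  show ?case
  proof (cases "F J = \<infinity> \<or> F K = \<infinity>")
    case True
    then show ?thesis using ninf by auto
  next
    case False
    then have FJ: "F J < \<infinity>" and FK: "F K < \<infinity>" by auto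
    define E where "E = even_ranked (K - J)"
    define O' where "O' = (K - J) - E"
    have ED: "E \<subseteq> K - J" unfolding E_def by (rule even_ranked_subset)
    have cE: "card E = card (K - J) div 2" unfolding E_def by (rule card_even_ranked[OF finD])
    have cO: "card O' = card (K - J) - card (K - J) div 2"
      unfolding O'_def using card_Diff_subset[of E "K - J"] ED cE finD finite_subset by fastforce
    have KE: "K - E = J \<union> O'" unfolding O'_def using ED JK by blast
    have half: "F (J \<union> E) + F (J \<union> O') \<le> F J + F K"
      using halve[OF finK JK] KE unfolding E_def by simp
    have finite_all: "F M < \<infinity>" if M: "J \<subseteq> M" "M \<subseteq> K" for M
    proof (cases "card (K - J) \<ge> 2")
      case False
      then have "card (K - J) \<le> Suc 0" by simp
      then have single: "\<forall>a\<in>K - J. \<forall>b\<in>K - J. a = b" using finD card_le_Suc0_iff_eq[of "K - J"] by simp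
      have "M = J \<or> M = K"
      proof (rule ccontr)
        assume "\<not> (M = J \<or> M = K)"
        then obtain a b where ab: "a \<in> M - J" "b \<in> K - M" using M by blast
        then have "a \<in> K - J" "b \<in> K - J" using M by auto
        then have "a = b" using single by simp
        then show False using ab by simp
      qed
      then show ?thesis using FJ FK by auto
    next
      case True
      then have "card E \<noteq> 0" "card O' \<noteq> 0" unfolding cE cO by linarith+
      then have E0: "E \<noteq> {}" and O0: "O' \<noteq> {}" by auto
      have "F (J \<union> E) + F (J \<union> O') < \<infinity>"
        by (rule le_less_trans[OF half]) (use FJ FK in simp)
      then have FE: "F (J \<union> E) < \<infinity>" and FO: "F (J \<union> O') < \<infinity>" by auto
      have sub: "J \<union> (M \<inter> E) \<subseteq> J \<union> E" "J \<union> E \<subseteq> M \<union> E" "M \<union> E \<subseteq> K" "J \<union> E \<subseteq> K"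
        using M ED JK by auto
      have proper: "J \<union> E \<noteq> K" "J \<union> E \<noteq> J" using E0 O0 ED unfolding O'_def by blast+
      have lo: "F (J \<union> (M \<inter> E)) < \<infinity>"
        by (rule IHfin[of J "J \<union> E"]) (use sub proper FJ FE in auto)
      have hi: "F (M \<union> E) < \<infinity>"
        by (rule IHfin[of "J \<union> E" K]) (use sub proper FK FE in auto)
      \<comment> \<open>The points of \<open>lo\<close> and \<open>hi\<close> enclose \<open>M\<close>; they span all of \<open>[J, K]\<close> only if \<open>M = J \<union> O'\<close>.\<close>
      show ?thesis
      proof (cases "J \<union> (M \<inter> E) = J \<and> M \<union> E = K")
        case True
        then have "M = J \<union> O'" using M ED unfolding O'_def by blast
        then show ?thesis using FO by simp
      next
        case False
        show ?thesis
          by (rule IHfin[of "J \<union> (M \<inter> E)" "M \<union> E"]) (use False lo hi sub M in auto)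
      qed
    qed
    have two: "F M + F (J \<union> (K - M)) \<le> F J + F K"
      if M: "J \<subseteq> M" "M \<subseteq> K" "M \<noteq> J" and c: "card (K - M) \<ge> 2" for M
    proof -
      obtain T where "T \<subseteq> K - M" "card T = 2" using obtain_subset_with_card_n[OF c] by blast
      then obtain a b where a: "a \<in> K - M" and b: "b \<in> K - M" "b \<noteq> a"
        unfolding card_2_iff by auto
      \<comment> \<open>Remove \<open>a\<close> from the top of the interval, then put it back on the complementary side.\<close>
      define N where "N = J \<union> (K - M - {a})"
      have N: "J \<subseteq> N" "N \<subseteq> K" "N \<noteq> J" using a b M unfolding N_def by auto
      have e1: "J \<union> ((K - {a}) - M) = N" unfolding N_def by blast
      have e2: "N \<union> (K - (J \<union> (K - M))) = K - {a}" using M a unfolding N_def by blast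
      have sub: "M \<subseteq> K - {a}" "K - {a} \<subseteq> K" "K - {a} \<noteq> K" using M a by auto
      have "N \<subseteq> J \<union> (K - M)" "J \<union> (K - M) \<subseteq> K" using JK by (auto simp: N_def)
      then have i2: "F (J \<union> (K - M)) + F (K - {a}) \<le> F N + F K"
        using IH[OF N(1) order_refl disjI1[OF N(3)], of "J \<union> (K - M)"] unfolding e2 by simp
      have i1: "F M + F N \<le> F J + F (K - {a})"
        using IH[OF order_refl sub(2) disjI2[OF sub(3)] M(1) sub(1)] unfolding e1 .
      have fin: "F N < \<infinity>" "F (K - {a}) < \<infinity>" "F M < \<infinity>" "F (J \<union> (K - M)) < \<infinity>"
        by (rule finite_all; use N M a JK in auto)+
      have real: "\<exists>r. F S = ereal r" if "F S < \<infinity>" for S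
        using that ninf[of S] by (cases "F S") auto
      obtain r1 r2 r3 r4 r5 r6 where "F N = ereal r1" "F (K - {a}) = ereal r2" "F M = ereal r3"
        "F (J \<union> (K - M)) = ereal r4" "F J = ereal r5" "F K = ereal r6"
        using real fin FJ FK by meson
      then show ?thesis using i1 i2 by simp
    qed
    have M: "J \<subseteq> M" "M \<subseteq> K" using less.prems by auto
    let ?M' = "J \<union> (K - M)"
    have M': "J \<subseteq> ?M'" "?M' \<subseteq> K" "K - ?M' = M - J" "J \<union> (K - ?M') = M" using M by auto
    consider "M = J" | "M = K" | "M \<noteq> J" "card (K - M) \<ge> 2"
      | "M \<noteq> K" "card (M - J) \<ge> 2" | "M \<noteq> J" "M \<noteq> K" "card (K - M) < 2" "card (M - J) < 2"
      by (metis linorder_not_le)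
    then show ?thesis
    proof cases
      case 1
      then show ?thesis using JK by (simp add: Un_absorb1)
    next
      case 2
      then show ?thesis by (simp add: add.commute)
    next
      case 3
      then show ?thesis using two M by blast
    next
      case 4
      then have "?M' \<noteq> J" using M by blast
      then show ?thesis using two[of ?M'] M' 4 by (simp add: add.commute)
    next
      case 5
      \<comment> \<open>Both halves are singletons, and halving splits them in one of the two orders.\<close>
      have "finite M" using finK M(2) finite_subset by blast
      then have "card (K - M) > 0" "card (M - J) > 0" using 5 M finK by (auto simp: card_gt_0_iff)
      then have "card (K - M) = 1" "card (M - J) = 1" using 5 by auto
      then obtain p q where p: "K - M = {p}" and q: "M - J = {q}"
        using card_1_singletonE by metis
      have "K - J = (K - M) \<union> (M - J)" using M by blast
      then have KJ: "K - J = {p, q}" unfolding p q by auto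
      have "p \<in> K - M" "q \<in> M - J" unfolding p q by auto
      then have pq: "p \<noteq> q" by auto
      have "card E = 1" using cE KJ pq by simp
      then obtain e where e: "E = {e}" using card_1_singletonE by metis
      have "J \<union> (M - J) = M" using M by blast
      then have JM: "J \<union> {q} = M" unfolding q .
      have "e = p \<and> O' = {q} \<or> e = q \<and> O' = {p}" using ED KJ pq e unfolding O'_def by auto
      then have "J \<union> E = ?M' \<and> J \<union> O' = M \<or> J \<union> E = M \<and> J \<union> O' = ?M'"
        using JM unfolding e p by auto
      then show ?thesis using half by (auto simp: add.commute)
    qed
  qed
qed

section \<open>The parallelogram inequality\<close>

lemma dim_\<mu> [simp]: "dim_vec (\<mu> x y) = dim_vec x"
  by (simp add: \<mu>_def)

lemma \<mu>_carrier: "x \<in> carrier_vec n \<Longrightarrow> \<mu> x y \<in> carrier_vec n"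
  by (intro carrier_vecI) simp

lemma \<mu>_index:
  assumes "i < dim_vec x"
  shows "\<mu> x y $ i = x $ i + sgn (y $ i - x $ i) * (\<bar>y $ i - x $ i\<bar> div 2)"
proof -
  have f: "\<lfloor>real_of_int a / 2\<rfloor> = a div 2" for a
    using floor_divide_of_int_eq[of a 2, where ?'a = real] by simp
  have c: "\<lceil>real_of_int a / 2\<rceil> = - ((- a) div 2)" for a
    using ceiling_divide_eq_div[of a 2, where ?'a = real] by simp
  show ?thesis
    using assms unfolding \<mu>_def index_vec[OF assms] f c by (auto simp: sgn_if)
qed

lemma DDM_convexD:
  "DDM_convex n f \<Longrightarrow> x \<in> carrier_vec n \<Longrightarrow> y \<in> carrier_vec n \<Longrightarrow> f (\<mu> x y) + f (\<mu> y x) \<le> f x + f y"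
  by (auto simp: DDM_convex_def)

text \<open>
  The point reached from \<open>x\<close> by performing the steps with levels in \<open>J\<close>, where step \<open>k\<close> moves each
  coordinate at distance at least \<open>k\<close> from its target one unit towards \<open>y\<close>. All levels together lead
  to \<open>y\<close>.
\<close>

definition path_point :: "int vec \<Rightarrow> int vec \<Rightarrow> nat set \<Rightarrow> int vec" where
  "path_point x y J = vec (dim_vec x) (\<lambda>i.
     x $ i + sgn (y $ i - x $ i) * int (card {k \<in> J. k \<le> nat \<bar>y $ i - x $ i\<bar>}))"

lemma path_point_carrier [simp]: "x \<in> carrier_vec n \<Longrightarrow> path_point x y J \<in> carrier_vec n"
  by (intro carrier_vecI) (simp add: path_point_def)

text \<open>
  Two path points with nested level sets differ, in each coordinate, by the number of extra levels
  that act on it. Rounding half of this number towards the first argument is counting the extra levels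
  of even rank, simultaneously for all coordinates.
\<close>

lemma \<mu>_path_point:
  assumes "finite K" "J \<subseteq> K"
  shows "\<mu> (path_point x y J) (path_point x y K) = path_point x y (J \<union> even_ranked (K - J))"
    and "\<mu> (path_point x y K) (path_point x y J) = path_point x y (K - even_ranked (K - J))"
proof -
  let ?E = "even_ranked (K - J)"
  let ?c = "\<lambda>S t. card {k \<in> S. k \<le> t}"
  have E: "?E \<subseteq> K - J" by (rule even_ranked_subset)
  have fin: "finite J" "finite ?E" "finite (K - J)" using assms E finite_subset by blast+
  have K: "?c K t = ?c J t + ?c (K - J) t" for t
    by (subst card_Un_disjoint[symmetric]) (use assms fin in \<open>auto intro!: arg_cong[where f = card]\<close>)
  have JE: "?c (J \<union> ?E) t = ?c J t + ?c (K - J) t div 2" for t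
    unfolding card_even_ranked_le[OF fin(3), symmetric]
    by (subst card_Un_disjoint[symmetric]) (use E fin in \<open>auto intro!: arg_cong[where f = card]\<close>)
  have KE: "?c K t = ?c (K - ?E) t + ?c (K - J) t div 2" for t
    unfolding card_even_ranked_le[OF fin(3), symmetric]
    by (subst card_Un_disjoint[symmetric])
      (use E assms fin in \<open>auto intro!: arg_cong[where f = card]\<close>)
  have half: "sgn (sgn d * int c) * (\<bar>sgn d * int c\<bar> div 2) = sgn d * int (c div 2)" for c and d :: int
    by (cases d "0 :: int" rule: linorder_cases) (auto simp: zdiv_int sgn_if)
  let ?p = "path_point x y"
  have diff: "?p K $ i - ?p J $ i = sgn (y $ i - x $ i) * int (?c (K - J) (nat \<bar>y $ i - x $ i\<bar>))"
    "?p J $ i - ?p K $ i = sgn (x $ i - y $ i) * int (?c (K - J) (nat \<bar>x $ i - y $ i\<bar>))"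
    if "i < dim_vec x" for i
  proof -
    have sym: "\<bar>x $ i - y $ i\<bar> = \<bar>y $ i - x $ i\<bar>" "sgn (x $ i - y $ i) = - sgn (y $ i - x $ i)"
      by (auto simp: sgn_if)
    show "?p K $ i - ?p J $ i = sgn (y $ i - x $ i) * int (?c (K - J) (nat \<bar>y $ i - x $ i\<bar>))"
      "?p J $ i - ?p K $ i = sgn (x $ i - y $ i) * int (?c (K - J) (nat \<bar>x $ i - y $ i\<bar>))"
      using that K[of "nat \<bar>y $ i - x $ i\<bar>"] unfolding sym
      by (simp_all add: path_point_def distrib_left)
  qed
  show "\<mu> (?p J) (?p K) = ?p (J \<union> ?E)"
  proof (rule eq_vecI)
    fix i assume "i < dim_vec (?p (J \<union> ?E))"
    then have i: "i < dim_vec x" by (simp add: path_point_def)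
    then have "\<mu> (?p J) (?p K) $ i =
        ?p J $ i + sgn (y $ i - x $ i) * int (?c (K - J) (nat \<bar>y $ i - x $ i\<bar>) div 2)"
      by (subst \<mu>_index) (simp add: path_point_def, simp only: diff half)
    then show "\<mu> (?p J) (?p K) $ i = ?p (J \<union> ?E) $ i"
      using i JE[of "nat \<bar>y $ i - x $ i\<bar>"] by (simp add: path_point_def distrib_left)
  qed (simp add: path_point_def)
  show "\<mu> (?p K) (?p J) = ?p (K - ?E)"
  proof (rule eq_vecI)
    fix i assume "i < dim_vec (?p (K - ?E))"
    then have i: "i < dim_vec x" by (simp add: path_point_def)
    have sym: "\<bar>x $ i - y $ i\<bar> = \<bar>y $ i - x $ i\<bar>" "sgn (x $ i - y $ i) = - sgn (y $ i - x $ i)"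
      by (auto simp: sgn_if)
    have "\<mu> (?p K) (?p J) $ i =
        ?p K $ i + sgn (x $ i - y $ i) * int (?c (K - J) (nat \<bar>x $ i - y $ i\<bar>) div 2)"
      using i by (subst \<mu>_index) (simp add: path_point_def, simp only: diff half)
    then show "\<mu> (?p K) (?p J) $ i = ?p (K - ?E) $ i"
      using i KE[of "nat \<bar>y $ i - x $ i\<bar>"] by (simp add: path_point_def distrib_left sym)
  qed (simp add: path_point_def)
qed

lemma path_point_empty: "path_point x y {} = x"
  by (rule eq_vecI) (auto simp: path_point_def)

lemma path_point_complement:
  assumes "dim_vec y = dim_vec x" "\<And>i. i < dim_vec x \<Longrightarrow> nat \<bar>y $ i - x $ i\<bar> \<le> m" "M \<subseteq> {1..m}"
  shows "path_point x y ({1..m} - M) = x + y - path_point x y M"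
proof (rule eq_vecI)
  fix i assume "i < dim_vec (x + y - path_point x y M)"
  then have i: "i < dim_vec x" by (simp add: path_point_def)
  define d where "d = y $ i - x $ i"
  define t where "t = nat \<bar>d\<bar>"
  have "t \<le> m" using assms(2)[OF i] unfolding t_def d_def .
  have "finite M" using assms(3) finite_subset by blast
  then have "card {k \<in> {1..m} - M. k \<le> t} + card {k \<in> M. k \<le> t} =
      card ({k \<in> {1..m} - M. k \<le> t} \<union> {k \<in> M. k \<le> t})"
    by (subst card_Un_disjoint) auto
  also have "{k \<in> {1..m} - M. k \<le> t} \<union> {k \<in> M. k \<le> t} = {1..t}"
    using assms(3) \<open>t \<le> m\<close> by auto
  finally have "card {k \<in> {1..m} - M. k \<le> t} + card {k \<in> M. k \<le> t} = card {1..t}" .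
  then have e: "int (card {k \<in> {1..m} - M. k \<le> t}) = int t - int (card {k \<in> M. k \<le> t})" by simp
  have "sgn d * int t = d" unfolding t_def by (simp add: sgn_if)
  then have "x $ i + sgn d * int (card {k \<in> {1..m} - M. k \<le> t}) =
      x $ i + y $ i - (x $ i + sgn d * int (card {k \<in> M. k \<le> t}))"
    unfolding e by (simp add: d_def right_diff_distrib)
  then show "path_point x y ({1..m} - M) $ i = (x + y - path_point x y M) $ i"
    using i assms(1) by (simp add: path_point_def d_def[symmetric] t_def[symmetric])
qed (use assms in \<open>simp add: path_point_def\<close>)

text \<open>
  Complementary sets of levels give points that are symmetric about the midpoint of \<open>x\<close> and \<open>y\<close>, so
  this is supermodularity of \<open>f\<close> along the path, between the empty set and the set of all levels.
\<close>

lemma parallelogram_inequality: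
  assumes f: "real_or_infty n f" "DDM_convex n f"
    and x: "x \<in> carrier_vec n" and y: "y \<in> carrier_vec n"
    and m: "\<And>i. i < n \<Longrightarrow> nat \<bar>y $ i - x $ i\<bar> \<le> m" and M: "M \<subseteq> {1..m}"
  shows "f (path_point x y M) + f (x + y - path_point x y M) \<le> f x + f y"
proof -
  have dims: "dim_vec y = dim_vec x" "dim_vec x = n" using x y by auto
  have full: "path_point x y {1..m} = y"
    using path_point_complement[of y x m "{}"] dims m x y by (auto simp: path_point_empty)
  have "f (path_point x y M) + f (path_point x y ({} \<union> ({1..m} - M))) \<le>
      f (path_point x y {}) + f (path_point x y {1..m})"
  proof (rule supermodular_of_halving[where F = "\<lambda>J. f (path_point x y J)"])
    fix J K :: "nat set" assume "finite K" "J \<subseteq> K"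
    then show "f (path_point x y (J \<union> even_ranked (K - J))) + f (path_point x y (K - even_ranked (K - J)))
        \<le> f (path_point x y J) + f (path_point x y K)"
      using DDM_convexD[OF f(2), of "path_point x y J" "path_point x y K"] x
      by (simp add: \<mu>_path_point)
  next
    show "f (path_point x y J) \<noteq> -\<infinity>" for J
      using f(1) x by (auto simp: real_or_infty_def)
  qed (use M in auto)
  moreover have "path_point x y ({} \<union> ({1..m} - M)) = x + y - path_point x y M"
    using path_point_complement[of y x m M] dims m M by auto
  ultimately show ?thesis unfolding path_point_empty full by simp
qed


section \<open>Scaling and proximity\<close>

lemma \<mu>_add_\<mu>:
  assumes "x \<in> carrier_vec n" "y \<in> carrier_vec n"
  shows "\<mu> x y + \<mu> y x = x + y"
proof (rule eq_vecI)
  fix i assume "i < dim_vec (x + y)"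
  then have i: "i < dim_vec x" "i < dim_vec y" using assms by auto
  have "\<bar>x $ i - y $ i\<bar> = \<bar>y $ i - x $ i\<bar>" "sgn (x $ i - y $ i) = - sgn (y $ i - x $ i)"
    by (auto simp: sgn_if)
  then show "(\<mu> x y + \<mu> y x) $ i = (x + y) $ i" using i by (simp add: \<mu>_index)
qed (use assms in auto)

text \<open>
  The levels \<open>3, 4, 7, 8, \<dots>\<close>: every second pair \<open>{2 s + 1, 2 s + 2}\<close>.
\<close>

lemma card_odd_even_pairs:
  "card {k \<in> {1..m}. even ((k + 1) div 2) \<and> k \<le> 2 * s} = 2 * (s div 2)" if "2 * s \<le> m" for m s :: nat
  using that
proof (induction s)
  case (Suc s)
  let ?A = "\<lambda>s. {k \<in> {1..m}. even ((k + 1) div 2) \<and> k \<le> 2 * s}"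
  have "?A (Suc s) = (if even (Suc s) then {2 * s + 1, 2 * s + 2} \<union> ?A s else ?A s)"
  proof (rule Set.set_eqI)
    fix k
    consider "k \<le> 2 * s" | "k = 2 * s + 1" | "k = 2 * s + 2" | "k > 2 * s + 2" by linarith
    then show "k \<in> ?A (Suc s) \<longleftrightarrow> k \<in> (if even (Suc s) then {2 * s + 1, 2 * s + 2} \<union> ?A s else ?A s)"
      using Suc.prems by cases auto
  qed
  moreover have "card ({2 * s + 1, 2 * s + 2} \<union> ?A s) = 2 + card (?A s)"
    by (subst card_Un_disjoint) auto
  ultimately show ?case using Suc by (auto elim!: evenE oddE)
qed simp

text \<open>
  Between \<open>2 a\<close> and \<open>2 b\<close> the levels act in pairs \<open>{2 s + 1, 2 s + 2}\<close>, and a pair is one step between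
  \<open>a\<close> and \<open>b\<close>. Selecting every second pair therefore doubles the midpoint of \<open>a\<close> and \<open>b\<close>.
\<close>

lemma DDM_convex_scale_two:
  assumes f: "real_or_infty n f" "DDM_convex n f"
  shows "DDM_convex n (\<lambda>z. f (2 \<cdot>\<^sub>v z))"
  unfolding DDM_convex_def
proof (intro ballI)
  fix a b :: "int vec" assume a: "a \<in> carrier_vec n" and b: "b \<in> carrier_vec n"
  define m where "m = (\<Sum>i<n. 2 * nat \<bar>b $ i - a $ i\<bar>)"
  define M where "M = {k \<in> {1..m}. even ((k + 1) div 2)}"
  have m: "2 * nat \<bar>b $ i - a $ i\<bar> \<le> m" if "i < n" for i
    unfolding m_def using that by (intro member_le_sum) auto
  have p: "path_point (2 \<cdot>\<^sub>v a) (2 \<cdot>\<^sub>v b) M = 2 \<cdot>\<^sub>v \<mu> a b"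
  proof (rule eq_vecI)
    fix i assume "i < dim_vec (2 \<cdot>\<^sub>v \<mu> a b)"
    then have i: "i < n" "i < dim_vec a" "i < dim_vec b" using a b by auto
    define d where "d = b $ i - a $ i"
    have e: "2 * b $ i - 2 * a $ i = 2 * d" unfolding d_def by simp
    have t: "nat \<bar>2 * d\<bar> = 2 * nat \<bar>d\<bar>" by auto
    have "{k \<in> M. k \<le> 2 * nat \<bar>d\<bar>} = {k \<in> {1..m}. even ((k + 1) div 2) \<and> k \<le> 2 * nat \<bar>d\<bar>}"
      unfolding M_def by auto
    then have c: "card {k \<in> M. k \<le> nat \<bar>2 * d\<bar>} = 2 * (nat \<bar>d\<bar> div 2)"
      using card_odd_even_pairs[of "nat \<bar>d\<bar>" m] m[OF i(1), folded d_def] unfolding t by simp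
    have "sgn (2 * d) = sgn d" by (simp add: sgn_if)
    then show "path_point (2 \<cdot>\<^sub>v a) (2 \<cdot>\<^sub>v b) M $ i = (2 \<cdot>\<^sub>v \<mu> a b) $ i"
      using i by (simp add: path_point_def e c \<mu>_index d_def[symmetric] zdiv_int)
  qed (simp add: path_point_def)
  have q: "2 \<cdot>\<^sub>v a + 2 \<cdot>\<^sub>v b - 2 \<cdot>\<^sub>v \<mu> a b = 2 \<cdot>\<^sub>v \<mu> b a"
  proof (rule eq_vecI)
    fix i assume "i < dim_vec (2 \<cdot>\<^sub>v \<mu> b a)"
    then have i: "i < dim_vec a" "i < dim_vec b" using a b by auto
    have "(\<mu> a b + \<mu> b a) $ i = (a + b) $ i" using \<mu>_add_\<mu>[OF a b] by simp
    then show "(2 \<cdot>\<^sub>v a + 2 \<cdot>\<^sub>v b - 2 \<cdot>\<^sub>v \<mu> a b) $ i = (2 \<cdot>\<^sub>v \<mu> b a) $ i" using i by simp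
  qed (use a b in auto)
  have "M \<subseteq> {1..m}" unfolding M_def by blast
  moreover have "nat \<bar>(2 \<cdot>\<^sub>v b) $ i - (2 \<cdot>\<^sub>v a) $ i\<bar> \<le> m" if "i < n" for i
    using m[OF that] that a b by simp
  ultimately show "f (2 \<cdot>\<^sub>v \<mu> a b) + f (2 \<cdot>\<^sub>v \<mu> b a) \<le> f (2 \<cdot>\<^sub>v a) + f (2 \<cdot>\<^sub>v b)"
    using parallelogram_inequality[OF f, of "2 \<cdot>\<^sub>v a" "2 \<cdot>\<^sub>v b" m M] a b unfolding p q
    by simp
qed

lemma real_or_infty_affine:
  assumes "real_or_infty n f" "x \<in> carrier_vec n"
  shows "real_or_infty n (\<lambda>z. f (x + \<alpha> \<cdot>\<^sub>v z))"
  using assms by (auto simp: real_or_infty_def)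

lemma DDM_convex_scale_pow2:
  assumes f: "real_or_infty n f" "DDM_convex n f" and x: "x \<in> carrier_vec n"
  shows "DDM_convex n (\<lambda>z. f (x + 2 ^ j \<cdot>\<^sub>v z))"
proof (induction j)
  case 0
  have "x + \<mu> a b = \<mu> (x + a) (x + b)" if "a \<in> carrier_vec n" "b \<in> carrier_vec n" for a b
    by (rule eq_vecI) (use x that in \<open>auto simp: \<mu>_index\<close>)
  then show ?case using f(2) x by (auto simp: DDM_convex_def)
next
  case (Suc j)
  have "2 ^ Suc j \<cdot>\<^sub>v z = 2 ^ j \<cdot>\<^sub>v (2 \<cdot>\<^sub>v z)" for z :: "int vec"
    by (simp add: smult_smult_assoc mult.commute)
  then show ?case using DDM_convex_scale_two[OF real_or_infty_affine[OF f(1) x] Suc] by simp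
qed

lemma add_smult_zero_vec: "x \<in> carrier_vec n \<Longrightarrow> x + (a::int) \<cdot>\<^sub>v 0\<^sub>v n = x"
  by (rule eq_vecI) auto

lemma norm_inf_le_iff:
  assumes "x \<in> carrier_vec n" "n \<ge> 1"
  shows "norm_inf x \<le> b \<longleftrightarrow> (\<forall>i<n. \<bar>x $ i\<bar> \<le> b)"
proof -
  have "0 \<in> {..<n}" using assms(2) by simp
  then have "(\<lambda>i. \<bar>x $ i\<bar>) ` {..<n} \<noteq> {}" by blast
  then show ?thesis using assms(1) by (auto simp: norm_inf_def)
qed

lemma norm_inf_zero: "n \<ge> 1 \<Longrightarrow> norm_inf (0\<^sub>v n) = 0"
  unfolding norm_inf_def by (simp add: lessThan_empty_iff image_constant_conv)

lemma norm_inf_nonneg: "x \<in> carrier_vec n \<Longrightarrow> n \<ge> 1 \<Longrightarrow> norm_inf x \<ge> 0"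
  using norm_inf_le_iff[of x n "norm_inf x"] by force

text \<open>
  Far from the origin a point can always be moved towards it by an even vector without increasing
  \<open>g\<close>; the sum of the absolute values of the coordinates decreases, so the process ends inside the
  box. Working with an arbitrary point \<open>w\<close> instead of a minimizer avoids having to know that \<open>g\<close>
  attains its minimum.
\<close>

lemma proximity_two:
  assumes n: "n \<ge> 1" and g: "real_or_infty n g" "DDM_convex n g"
    and g0: "g (0\<^sub>v n) < \<infinity>" and min: "\<And>z. z \<in> carrier_vec n \<Longrightarrow> g (0\<^sub>v n) \<le> g (2 \<cdot>\<^sub>v z)"
    and w: "w \<in> carrier_vec n"
  shows "\<exists>w'\<in>carrier_vec n. norm_inf w' \<le> int n \<and> g w' \<le> g w"
  using w
proof (induction "\<Sum>i<n. nat \<bar>w $ i\<bar>" arbitrary: w rule: less_induct)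
  case less
  have w: "w \<in> carrier_vec n" by fact
  show ?case
  proof (cases "norm_inf w \<le> int n")
    case True
    then show ?thesis using w by blast
  next
    case False
    then obtain i0 where i0: "i0 < n" "\<bar>w $ i0\<bar> > int n"
      using norm_inf_le_iff[OF w n] by (auto simp: not_le)
    \<comment> \<open>Besides \<open>i0\<close> there are only \<open>n - 1\<close> coordinates to hit the \<open>n\<close> levels.\<close>
    have "\<exists>k\<in>{1..n}. \<forall>i<n. nat \<bar>w $ i\<bar> \<noteq> k"
    proof (rule ccontr)
      assume "\<not> ?thesis"
      then have all: "\<exists>i<n. nat \<bar>w $ i\<bar> = k" if "k \<in> {1..n}" for k using that by blast
      have "{1..n} \<subseteq> (\<lambda>i. nat \<bar>w $ i\<bar>) ` ({..<n} - {i0})"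
      proof
        fix k assume k: "k \<in> {1..n}"
        then obtain i where i: "i < n" "nat \<bar>w $ i\<bar> = k" using all by blast
        then have "i \<noteq> i0" using i0(2) k by auto
        then show "k \<in> (\<lambda>i. nat \<bar>w $ i\<bar>) ` ({..<n} - {i0})" using i by blast
      qed
      then have "card {1..n} \<le> card ({..<n} - {i0})" by (intro surj_card_le) auto
      then show False using i0(1) by simp
    qed
    then obtain k where k: "1 \<le> k" "k \<le> n" "\<And>i. i < n \<Longrightarrow> nat \<bar>w $ i\<bar> \<noteq> k" by auto
    define m where "m = (\<Sum>i<n. nat \<bar>w $ i\<bar>)"
    have m: "nat \<bar>w $ i\<bar> \<le> m" if "i < n" for i
      unfolding m_def using that by (intro member_le_sum) auto
    \<comment> \<open>As level \<open>k\<close> is not hit, steps \<open>k\<close> and \<open>k + 1\<close> move the same coordinates and make up \<open>2 z\<close>.\<close>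
    define z where "z = vec n (\<lambda>i. if \<bar>w $ i\<bar> > int k then sgn (w $ i) else 0)"
    have z: "z \<in> carrier_vec n" by (simp add: z_def)
    have p: "path_point (0\<^sub>v n) w {k, k + 1} = 2 \<cdot>\<^sub>v z"
    proof (rule eq_vecI)
      fix i assume "i < dim_vec (2 \<cdot>\<^sub>v z)"
      then have i: "i < n" using z by simp
      have "{l \<in> {k, k + 1}. l \<le> nat \<bar>w $ i\<bar>} = (if \<bar>w $ i\<bar> > int k then {k, k + 1} else {})"
        using k(3)[OF i] by auto
      then have "int (card {l \<in> {k, k + 1}. l \<le> nat \<bar>w $ i\<bar>}) = (if \<bar>w $ i\<bar> > int k then 2 else 0)"
        by simp
      then show "path_point (0\<^sub>v n) w {k, k + 1} $ i = (2 \<cdot>\<^sub>v z) $ i"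
        using i unfolding path_point_def z_def by simp
    qed (simp add: path_point_def z_def)
    define v where "v = 0\<^sub>v n + w - 2 \<cdot>\<^sub>v z"
    have v: "v \<in> carrier_vec n" using w z by (simp add: v_def)
    have vi: "v $ i = w $ i - 2 * z $ i" if "i < n" for i using that w z by (simp add: v_def)
    have "{k, k + 1} \<subseteq> {1..m}" using k m[OF i0(1)] i0(2) by auto
    then have "g (2 \<cdot>\<^sub>v z) + g v \<le> g (0\<^sub>v n) + g w"
      using parallelogram_inequality[OF g, of "0\<^sub>v n" w m "{k, k + 1}"] w m unfolding p v_def by simp
    moreover have "\<bar>g (0\<^sub>v n)\<bar> \<noteq> \<infinity>" using g0 g(1) by (auto simp: real_or_infty_def)
    ultimately have gv: "g v \<le> g w" by (rule ereal_add_le_cancel_lower[OF _ min[OF z]])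
    have "(\<Sum>i<n. nat \<bar>v $ i\<bar>) < (\<Sum>i<n. nat \<bar>w $ i\<bar>)"
    proof (rule sum_strict_mono_ex1)
      have "nat \<bar>v $ i\<bar> \<le> nat \<bar>w $ i\<bar>" if "i < n" for i
        using that k(1) by (auto simp: vi z_def sgn_if)
      then show "\<forall>i\<in>{..<n}. nat \<bar>v $ i\<bar> \<le> nat \<bar>w $ i\<bar>" by simp
      have "nat \<bar>v $ i0\<bar> < nat \<bar>w $ i0\<bar>"
        using i0 k by (auto simp: vi z_def sgn_if)
      then show "\<exists>i\<in>{..<n}. nat \<bar>v $ i\<bar> < nat \<bar>w $ i\<bar>" using i0(1) by blast
    qed simp
    then obtain w' where "w' \<in> carrier_vec n" "norm_inf w' \<le> int n" "g w' \<le> g v"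
      using less.hyps v by blast
    then show ?thesis using gv order_trans by blast
  qed
qed

section \<open>Steepest descent\<close>

lemma edomD:
  assumes "real_or_infty n h" "y \<in> edom n h"
  shows "y \<in> carrier_vec n" "\<bar>h y\<bar> \<noteq> \<infinity>"
  using assms by (auto simp: real_or_infty_def edom_def)

lemma norm_inf_\<mu>_diff:
  assumes n: "n \<ge> 1" and xy: "x \<in> carrier_vec n" "y \<in> carrier_vec n" and b: "norm_inf (y - x) \<le> b"
  shows "norm_inf (\<mu> x y - x) \<le> b div 2" "norm_inf (\<mu> y x - x) \<le> (b + 1) div 2"
proof -
  have d: "\<bar>y $ i - x $ i\<bar> \<le> b" if "i < n" for i
    using b norm_inf_le_iff[of "y - x" n b] n xy that by auto
  have "\<bar>(\<mu> x y - x) $ i\<bar> \<le> b div 2" "\<bar>(\<mu> y x - x) $ i\<bar> \<le> (b + 1) div 2" if "i < n" for i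
    using d[OF that] that xy by (auto simp: \<mu>_index sgn_if)
  moreover have "\<mu> x y - x \<in> carrier_vec n" "\<mu> y x - x \<in> carrier_vec n"
    using xy by (auto simp: \<mu>_carrier)
  ultimately show "norm_inf (\<mu> x y - x) \<le> b div 2" "norm_inf (\<mu> y x - x) \<le> (b + 1) div 2"
    using n by (auto simp: norm_inf_le_iff)
qed

text \<open>
  For \<open>y\<close> at distance at least two, both midpoints are closer to \<open>x\<close> than \<open>y\<close>, so by induction
  neither value is below \<open>h x\<close>, and neither is their sum minus \<open>h x\<close>, a lower bound for \<open>h y\<close>.
\<close>

lemma local_min_imp_global_min:
  assumes n: "n \<ge> 1" and h: "real_or_infty n h" "DDM_convex n h" and x: "x \<in> edom n h"
    and loc: "\<And>z. z \<in> N1 n x \<Longrightarrow> h x \<le> h z"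
  shows "y \<in> carrier_vec n \<Longrightarrow> h x \<le> h y"
proof (induction "nat (norm_inf (y - x))" arbitrary: y rule: less_induct)
  case less
  note y = less.prems
  have xc: "x \<in> carrier_vec n" "\<bar>h x\<bar> \<noteq> \<infinity>" using edomD[OF h(1) x] by auto
  show ?case
  proof (cases "norm_inf (y - x) \<le> 1")
    case True
    then show ?thesis using loc y by (simp add: N1_def)
  next
    case False
    have "norm_inf (\<mu> x y - x) < norm_inf (y - x)" "norm_inf (\<mu> y x - x) < norm_inf (y - x)"
      using norm_inf_\<mu>_diff[OF n xc(1) y order_refl] False by linarith+
    then have "h x \<le> h (\<mu> x y)" "h x \<le> h (\<mu> y x)"
      using less.hyps[of "\<mu> x y"] less.hyps[of "\<mu> y x"] False xc y by (auto simp: \<mu>_carrier)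
    moreover have "h (\<mu> x y) + h (\<mu> y x) \<le> h x + h y" using DDM_convexD[OF h(2) xc(1) y] .
    ultimately show ?thesis using xc(2) ereal_add_le_cancel_lower order_trans by meson
  qed
qed

text \<open>
  The two midpoints of \<open>y\<close> and \<open>w\<close> are not treated alike: \<open>\<mu> y w\<close> stays in the smaller box, where
  \<open>y\<close> is minimal, so \<open>\<mu> w y\<close>, which is closer to \<open>y\<close>, is at least as good as \<open>w\<close>. Repeating this
  ends at a neighbour of \<open>y\<close>.
\<close>

lemma minimizer_on_larger_box:
  assumes n: "n \<ge> 1" and h: "real_or_infty n h" "DDM_convex n h"
    and y: "y \<in> edom n h" "norm_inf y \<le> k"
    and ymin: "\<And>v. v \<in> carrier_vec n \<Longrightarrow> norm_inf v \<le> k \<Longrightarrow> h y \<le> h v"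
    and zmin: "\<And>v. v \<in> N1 n y \<Longrightarrow> h z \<le> h v"
  shows "w \<in> carrier_vec n \<Longrightarrow> norm_inf w \<le> k + 1 \<Longrightarrow> h z \<le> h w"
proof (induction "nat (norm_inf (w - y))" arbitrary: w rule: less_induct)
  case less
  note w = less.prems
  have yc: "y \<in> carrier_vec n" "\<bar>h y\<bar> \<noteq> \<infinity>" using edomD[OF h(1) y(1)] by auto
  show ?case
  proof (cases "norm_inf (w - y) \<le> 1")
    case True
    then show ?thesis using zmin w by (simp add: N1_def)
  next
    case False
    have yi: "\<bar>y $ i\<bar> \<le> k" and wi: "\<bar>w $ i\<bar> \<le> k + 1" if "i < n" for i
      using that y(2) w norm_inf_le_iff[OF yc(1) n] norm_inf_le_iff[OF w(1) n] by auto
    have "\<bar>\<mu> y w $ i\<bar> \<le> k" "\<bar>\<mu> w y $ i\<bar> \<le> k + 1" if "i < n" for i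
      using yi[OF that] wi[OF that] that yc(1) w(1) by (auto simp: \<mu>_index sgn_if)
    then have nm: "norm_inf (\<mu> y w) \<le> k" "norm_inf (\<mu> w y) \<le> k + 1"
      using n yc(1) w(1) by (auto simp: norm_inf_le_iff[of _ n] \<mu>_carrier)
    have "norm_inf (\<mu> w y - y) < norm_inf (w - y)"
      using norm_inf_\<mu>_diff(2)[OF n yc(1) w(1) order_refl] False by linarith
    then have "h z \<le> h (\<mu> w y)"
      using less.hyps[of "\<mu> w y"] nm False w by (auto simp: \<mu>_carrier)
    moreover have "h y \<le> h (\<mu> y w)" using ymin nm yc(1) by (simp add: \<mu>_carrier)
    moreover have "h (\<mu> y w) + h (\<mu> w y) \<le> h y + h w" using DDM_convexD[OF h(2) yc(1) w(1)] .
    ultimately show ?thesis using yc(2) ereal_add_le_cancel_lower order_trans by meson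
  qed
qed

text \<open>
  The last argument counts the oracle calls made so far. While searching, it also bounds the distance
  travelled from the origin and is the radius within which the current point is minimal.
\<close>

fun descent_invariant :: "nat \<Rightarrow> (int vec \<Rightarrow> ereal) \<Rightarrow> descent_state \<Rightarrow> nat \<Rightarrow> bool" where
  "descent_invariant n h (Search y) k \<longleftrightarrow> y \<in> edom n h \<and> k \<le> n \<and> norm_inf y \<le> int k \<and>
     (\<forall>v\<in>carrier_vec n. norm_inf v \<le> int k \<longrightarrow> h y \<le> h v)"
| "descent_invariant n h (Found y) k \<longleftrightarrow> y \<in> edom n h \<and> k \<le> n + 1 \<and>
     (\<forall>v\<in>carrier_vec n. h y \<le> h v)"

lemma descent_invariant_le: "descent_invariant n h d k \<Longrightarrow> k \<le> n + 1"
  by (cases d) auto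

lemma descent_invariant_start:
  assumes n: "n \<ge> 1" and "h (0\<^sub>v n) < \<infinity>"
  shows "descent_invariant n h (Search (0\<^sub>v n)) 0"
proof -
  have "v = 0\<^sub>v n" if "v \<in> carrier_vec n" "norm_inf v \<le> 0" for v
    by (rule eq_vecI) (use that norm_inf_le_iff[OF that(1) n, of 0] in auto)
  then show ?thesis using assms by (auto simp: edom_def norm_inf_zero)
qed

lemma oracle_answerD:
  assumes "oracle_answer n h y z"
  shows "y \<in> edom n h" "z \<in> N1 n y" "\<And>v. v \<in> N1 n y \<Longrightarrow> h z \<le> h v"
  using assms by (auto simp: oracle_answer_def is_arg_min_def not_less)

lemma center_in_N1:
  assumes "n \<ge> 1" "y \<in> carrier_vec n"
  shows "y \<in> N1 n y"
  using assms by (simp add: N1_def norm_inf_zero)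

lemma descent_invariant_step:
  assumes n: "n \<ge> 1" and h: "real_or_infty n h" "DDM_convex n h"
    and box: "\<And>v. v \<in> edom n h \<Longrightarrow> norm_inf v \<le> int n"
    and step: "descent_step n h d d'" and inv: "descent_invariant n h d k"
  shows "descent_invariant n h d' (Suc k)"
  using step
proof cases
  case (move y z)
  note o = oracle_answerD[OF move(3)]
  have y: "y \<in> edom n h" "k \<le> n" "norm_inf y \<le> int k"
    and ymin: "\<And>v. v \<in> carrier_vec n \<Longrightarrow> norm_inf v \<le> int k \<Longrightarrow> h y \<le> h v"
    using inv move by auto
  have yc: "y \<in> carrier_vec n" using edomD[OF h(1) y(1)] by simp
  have zy: "h z \<le> h y" using o(3) center_in_N1[OF n yc] by blast
  have z: "z \<in> edom n h" using o(2) zy y(1) by (auto simp: N1_def edom_def)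
  have zc: "z \<in> carrier_vec n" using z by (simp add: edom_def)
  \<comment> \<open>After \<open>n\<close> moves the whole box has been searched, so a further move cannot improve.\<close>
  have "k \<noteq> n"
  proof
    assume "k = n"
    then have "h y \<le> h z" using ymin[OF zc] box[OF z] by simp
    then show False using zy move(4) by simp
  qed
  have zm: "h z \<le> h v" if "v \<in> carrier_vec n" "norm_inf v \<le> int k + 1" for v
    by (rule minimizer_on_larger_box[OF n h y(1,3) ymin o(3) that])
  have "\<bar>z $ i\<bar> \<le> int k + 1" if "i < n" for i
  proof -
    have "\<bar>z $ i - y $ i\<bar> \<le> 1"
      using o(2) norm_inf_le_iff[of "z - y" n 1] n that yc zc by (auto simp: N1_def)
    moreover have "\<bar>y $ i\<bar> \<le> int k" using y(3) norm_inf_le_iff[OF yc n] that by blast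
    ultimately show ?thesis by linarith
  qed
  then have "norm_inf z \<le> int k + 1" using norm_inf_le_iff[OF zc n] by blast
  then show ?thesis using z zm \<open>k \<noteq> n\<close> y(2) move(2) by (auto simp: add.commute)
next
  case (halt y z)
  note o = oracle_answerD[OF halt(3)]
  have "h y \<le> h v" if "v \<in> N1 n y" for v using o(3)[OF that] halt(4) by simp
  then have "h y \<le> h v" if "v \<in> carrier_vec n" for v
    using local_min_imp_global_min[OF n h o(1) _ that] by blast
  then show ?thesis using inv o(1) halt by simp
qed

lemma finite_N1:
  assumes n: "n \<ge> 1" and y: "y \<in> carrier_vec n"
  shows "finite (N1 n y)"
proof (rule finite_subset)
  let ?S = "PiE {..<n} (\<lambda>i. {y $ i - 1..y $ i + 1})"
  show "finite (vec n ` ?S)" by (intro finite_imageI finite_PiE) auto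
  show "N1 n y \<subseteq> vec n ` ?S"
  proof
    fix z assume "z \<in> N1 n y"
    then have z: "z \<in> carrier_vec n" "norm_inf (z - y) \<le> 1" by (auto simp: N1_def)
    have "z $ i \<in> {y $ i - 1..y $ i + 1}" if "i < n" for i
    proof -
      have "\<bar>z $ i - y $ i\<bar> \<le> 1" using z norm_inf_le_iff[of "z - y" n 1] n that y by auto
      then show ?thesis by auto
    qed
    then have "restrict (\<lambda>i. z $ i) {..<n} \<in> ?S" unfolding restrict_PiE_iff by blast
    moreover have "z = vec n (restrict (\<lambda>i. z $ i) {..<n})" by (rule eq_vecI) (use z in auto)
    ultimately show "z \<in> vec n ` ?S" by blast
  qed
qed

lemma descent_step_exists:
  assumes n: "n \<ge> 1" and y: "y \<in> edom n h"
  shows "\<exists>d'. descent_step n h (Search y) d'"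
proof -
  have yc: "y \<in> carrier_vec n" using y by (simp add: edom_def)
  have "N1 n y \<noteq> {}" using center_in_N1[OF n yc] by blast
  then have "\<exists>z. is_arg_min h (\<lambda>z. z \<in> N1 n y) z"
    using ex_is_arg_min_if_finite[OF finite_N1[OF n yc]] by blast
  then obtain z where "oracle_answer n h y z" using y by (auto simp: oracle_answer_def)
  then show ?thesis by (cases "h z = h y") (auto intro: descent_step.intros)
qed

section \<open>The scaling algorithm\<close>

lemma scaled_box_properties:
  assumes n: "n \<ge> 1" and f: "real_or_infty n f" "DDM_convex n f" and x: "x \<in> carrier_vec n"
  shows "real_or_infty n (scaled_box n f x \<alpha>)"
    and "DDM_convex n (scaled_box n f x (2 ^ j))"
    and "v \<in> edom n (scaled_box n f x \<alpha>) \<Longrightarrow> norm_inf v \<le> int n"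
proof -
  show "real_or_infty n (scaled_box n f x \<alpha>)"
    using real_or_infty_affine[OF f(1) x, of \<alpha>] by (auto simp: real_or_infty_def scaled_box_def)
  show "v \<in> edom n (scaled_box n f x \<alpha>) \<Longrightarrow> norm_inf v \<le> int n"
    by (auto simp: edom_def scaled_box_def split: if_splits)
  have box: "norm_inf (\<mu> a b) \<le> int n"
    if ab: "a \<in> carrier_vec n" "b \<in> carrier_vec n" "norm_inf a \<le> int n" "norm_inf b \<le> int n" for a b
  proof -
    have "\<bar>\<mu> a b $ i\<bar> \<le> int n" if "i < n" for i
    proof -
      have "\<bar>a $ i\<bar> \<le> int n" "\<bar>b $ i\<bar> \<le> int n" using ab n that by (auto simp: norm_inf_le_iff)
      then show ?thesis using that ab by (auto simp: \<mu>_index sgn_if)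
    qed
    then show ?thesis using ab n by (auto simp: norm_inf_le_iff[of _ n] \<mu>_carrier)
  qed
  have "scaled_box n f x (2 ^ j) (\<mu> a b) + scaled_box n f x (2 ^ j) (\<mu> b a)
      \<le> scaled_box n f x (2 ^ j) a + scaled_box n f x (2 ^ j) b"
    if ab: "a \<in> carrier_vec n" "b \<in> carrier_vec n" for a b
  proof (cases "norm_inf a \<le> int n \<and> norm_inf b \<le> int n")
    case True
    then show ?thesis
      using DDM_convexD[OF DDM_convex_scale_pow2[OF f x] ab, of j] ab box by (simp add: scaled_box_def)
  next
    case False
    then show ?thesis by (auto simp: scaled_box_def)
  qed
  then show "DDM_convex n (scaled_box n f x (2 ^ j))" by (simp add: DDM_convex_def)
qed

text \<open>
  Applied to \<open>z \<mapsto> f (x + 2\<^sup>j z)\<close>, proximity turns the outcome of the previous phase, minimality of \<open>x\<close>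
  at scale \<open>2\<^sup>j\<^sup>+\<^sup>1\<close>, into the guarantee that restricting the search to the box loses nothing.
\<close>

lemma box_minimizer_is_scaled_minimizer:
  assumes n: "n \<ge> 1" and f: "real_or_infty n f" "DDM_convex n f" and x: "x \<in> edom n f"
    and coarse: "\<And>z. z \<in> carrier_vec n \<Longrightarrow> f x \<le> f (x + (2 * 2 ^ j) \<cdot>\<^sub>v z)"
    and y: "y \<in> edom n (scaled_box n f x (2 ^ j))"
    and ymin: "\<And>v. v \<in> carrier_vec n \<Longrightarrow> scaled_box n f x (2 ^ j) y \<le> scaled_box n f x (2 ^ j) v"
  shows "x + 2 ^ j \<cdot>\<^sub>v y \<in> edom n f"
    and "w \<in> carrier_vec n \<Longrightarrow> f (x + 2 ^ j \<cdot>\<^sub>v y) \<le> f (x + 2 ^ j \<cdot>\<^sub>v w)"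
proof -
  let ?g = "\<lambda>z. f (x + 2 ^ j \<cdot>\<^sub>v z)"
  have xc: "x \<in> carrier_vec n" using x by (simp add: edom_def)
  have yc: "y \<in> carrier_vec n" "norm_inf y \<le> int n" "?g y < \<infinity>"
    using y by (auto simp: edom_def scaled_box_def split: if_splits)
  then show "x + 2 ^ j \<cdot>\<^sub>v y \<in> edom n f" using xc by (simp add: edom_def)
  assume w: "w \<in> carrier_vec n"
  have g0: "?g (0\<^sub>v n) = f x" using xc by (simp add: add_smult_zero_vec)
  have "?g (0\<^sub>v n) \<le> ?g (2 \<cdot>\<^sub>v z)" if "z \<in> carrier_vec n" for z
    using coarse[OF that] unfolding g0 by (simp add: smult_smult_assoc mult.commute)
  moreover have "?g (0\<^sub>v n) < \<infinity>" unfolding g0 using x by (simp add: edom_def)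
  ultimately obtain w' where w': "w' \<in> carrier_vec n" "norm_inf w' \<le> int n" "?g w' \<le> ?g w"
    using proximity_two[OF n real_or_infty_affine[OF f(1) xc] DDM_convex_scale_pow2[OF f xc] _ _ w]
    by blast
  then have "?g y \<le> ?g w'" using ymin[OF w'(1)] yc by (simp add: scaled_box_def)
  then show "?g y \<le> ?g w" using w'(3) by simp
qed

text \<open>
  At scale \<open>2\<^sup>j\<close> the centre \<open>x\<close> is minimal among its translates by multiples of \<open>2\<^sup>j\<^sup>+\<^sup>1\<close>, and the
  \<open>m - j\<close> phases already completed account for at most \<open>n + 1\<close> calls each.
\<close>

fun scaling_invariant :: "nat \<Rightarrow> (int vec \<Rightarrow> ereal) \<Rightarrow> nat \<Rightarrow> scaling_state \<Rightarrow> bool" where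
  "scaling_invariant n f m (Phase x \<alpha> d c) \<longleftrightarrow> (\<exists>j k. j \<le> m \<and> \<alpha> = 2 ^ j \<and> x \<in> edom n f \<and>
     (\<forall>z\<in>carrier_vec n. f x \<le> f (x + (2 * 2 ^ j) \<cdot>\<^sub>v z)) \<and>
     descent_invariant n (scaled_box n f x (2 ^ j)) d k \<and> c \<le> (n + 1) * (m - j) + k)"
| "scaling_invariant n f m (Stopped x c) \<longleftrightarrow> x \<in> carrier_vec n \<and>
     (\<forall>z\<in>carrier_vec n. f x \<le> f z) \<and> c \<le> (n + 1) * (m + 1)"

lemma scaling_invariant_step:
  assumes n: "n \<ge> 1" and f: "real_or_infty n f" "DDM_convex n f"
    and step: "scaling_step n f s s'" and inv: "scaling_invariant n f m s"
  shows "scaling_invariant n f m s'"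
  using step
proof cases
  case (descend x \<alpha> d d' c)
  then obtain j k where jk: "j \<le> m" "\<alpha> = 2 ^ j" "x \<in> edom n f"
    "\<forall>z\<in>carrier_vec n. f x \<le> f (x + (2 * 2 ^ j) \<cdot>\<^sub>v z)"
    "descent_invariant n (scaled_box n f x (2 ^ j)) d k" "c \<le> (n + 1) * (m - j) + k"
    using inv by auto
  have xc: "x \<in> carrier_vec n" using jk by (simp add: edom_def)
  have st: "descent_step n (scaled_box n f x (2 ^ j)) d d'" using descend(3) jk(2) by simp
  note b = scaled_box_properties[OF n f xc]
  have "descent_invariant n (scaled_box n f x (2 ^ j)) d' (Suc k)"
    by (rule descent_invariant_step[OF n b(1) b(2) b(3) st jk(5)])
  moreover have "Suc c \<le> (n + 1) * (m - j) + Suc k" using jk(6) by simp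
  ultimately show ?thesis unfolding descend(2) scaling_invariant.simps using jk(1-4) by blast
next
  case (stop \<alpha> x y c)
  then obtain j k where jk: "j \<le> m" "\<alpha> = 2 ^ j" "x \<in> edom n f"
    "\<forall>z\<in>carrier_vec n. f x \<le> f (x + (2 * 2 ^ j) \<cdot>\<^sub>v z)"
    "descent_invariant n (scaled_box n f x (2 ^ j)) (Found y) k" "c \<le> (n + 1) * (m - j) + k"
    using inv by auto
  have "odd ((2::int) ^ j)" using jk(2) stop(3) by (metis odd_one)
  then have j: "j = 0" by simp
  have xc: "x \<in> carrier_vec n" using jk by (simp add: edom_def)
  have y: "y \<in> edom n (scaled_box n f x (2 ^ j))" "k \<le> n + 1" using jk(5) by auto
  note bm = box_minimizer_is_scaled_minimizer[OF n f jk(3) _ y(1)]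
  have res: "x + 2 ^ j \<cdot>\<^sub>v y \<in> edom n f"
    "\<And>w. w \<in> carrier_vec n \<Longrightarrow> f (x + 2 ^ j \<cdot>\<^sub>v y) \<le> f (x + 2 ^ j \<cdot>\<^sub>v w)"
    using bm jk(4,5) by auto
  have "f (x + 2 ^ j \<cdot>\<^sub>v y) \<le> f z" if z: "z \<in> carrier_vec n" for z
  proof -
    have "x + 2 ^ j \<cdot>\<^sub>v (z - x) = z" by (rule eq_vecI) (use z xc j in auto)
    then show ?thesis using res(2)[of "z - x"] z xc by simp
  qed
  moreover have "c \<le> (n + 1) * (m + 1)" using jk(6) y(2) j by simp
  ultimately show ?thesis using res(1) stop jk(2) by (auto simp: edom_def)
next
  case (rescale \<alpha> x y c)
  then obtain j k where jk: "j \<le> m" "\<alpha> = 2 ^ j" "x \<in> edom n f"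
    "\<forall>z\<in>carrier_vec n. f x \<le> f (x + (2 * 2 ^ j) \<cdot>\<^sub>v z)"
    "descent_invariant n (scaled_box n f x (2 ^ j)) (Found y) k" "c \<le> (n + 1) * (m - j) + k"
    using inv by auto
  obtain i where i: "j = Suc i" using jk(2) rescale(3) by (cases j) auto
  have xc: "x \<in> carrier_vec n" using jk by (simp add: edom_def)
  have y: "y \<in> edom n (scaled_box n f x (2 ^ j))" "k \<le> n + 1" using jk(5) by auto
  have yc: "y \<in> carrier_vec n" using y(1) by (simp add: edom_def)
  note bm = box_minimizer_is_scaled_minimizer[OF n f jk(3) _ y(1)]
  have res: "x + 2 ^ j \<cdot>\<^sub>v y \<in> edom n f"
    "\<And>w. w \<in> carrier_vec n \<Longrightarrow> f (x + 2 ^ j \<cdot>\<^sub>v y) \<le> f (x + 2 ^ j \<cdot>\<^sub>v w)"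
    using bm jk(4,5) by auto
  let ?x = "x + 2 ^ j \<cdot>\<^sub>v y"
  have "f ?x \<le> f (?x + (2 * 2 ^ i) \<cdot>\<^sub>v z)" if z: "z \<in> carrier_vec n" for z
  proof -
    have "?x + (2 * 2 ^ i) \<cdot>\<^sub>v z = x + 2 ^ j \<cdot>\<^sub>v (y + z)"
      by (rule eq_vecI) (use z xc yc i in \<open>auto simp: algebra_simps\<close>)
    then show ?thesis using res(2)[of "y + z"] z yc by simp
  qed
  moreover have "descent_invariant n (scaled_box n f ?x (2 ^ i)) (Search (0\<^sub>v n)) 0"
    by (rule descent_invariant_start[OF n])
      (use res(1) n in \<open>simp add: scaled_box_def norm_inf_zero edom_def add_smult_zero_vec[of ?x n]\<close>)
  moreover have "c \<le> (n + 1) * (m - i) + 0"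
  proof -
    have "m - i = Suc (m - j)" using jk(1) i by simp
    then show ?thesis using jk(6) y(2) by simp
  qed
  moreover have "i \<le> m" using jk(1) i by simp
  moreover have "\<alpha> div 2 = 2 ^ i" using jk(2) i by simp
  ultimately show ?thesis using res(1) unfolding rescale(2) jk(2)[symmetric] scaling_invariant.simps
    by blast
qed

lemma scaling_invariant_calls_le:
  assumes "scaling_invariant n f m (Phase x \<alpha> d c)"
  shows "c \<le> (n + 1) * (m + 1)"
proof -
  obtain j k where jk: "j \<le> m" "c \<le> (n + 1) * (m - j) + k" "k \<le> n + 1"
    using assms descent_invariant_le by auto
  then have "c \<le> (n + 1) * Suc (m - j)" by simp
  also have "\<dots> \<le> (n + 1) * (m + 1)" by (intro mult_left_mono) auto
  finally show ?thesis .
qed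

lemma scaling_step_exists:
  assumes n: "n \<ge> 1" and inv: "scaling_invariant n f m (Phase x \<alpha> d c)"
  shows "\<exists>s'. scaling_step n f (Phase x \<alpha> d c) s'"
proof (cases d)
  case (Search y)
  then have "y \<in> edom n (scaled_box n f x \<alpha>)" using inv by auto
  then show ?thesis using descent_step_exists[OF n] Search by (blast intro: scaling_step.intros)
next
  case (Found y)
  then show ?thesis by (cases "\<alpha> = 1") (blast intro: scaling_step.intros)+
qed

text \<open>
  With \<open>b\<close> a bound on the number of calls, an oracle call lowers \<open>2 * (b - c)\<close> by two. The extra unit
  for a finished phase pays for the transition to the next one, which makes no call.
\<close>

fun remaining_work :: "nat \<Rightarrow> scaling_state \<Rightarrow> nat" where
  "remaining_work b (Phase x \<alpha> (Search y) c) = 2 * (b - c) + 1"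
| "remaining_work b (Phase x \<alpha> (Found y) c) = 2 * (b - c) + 2"
| "remaining_work b (Stopped x c) = 0"

lemma remaining_work_decreases:
  assumes n: "n \<ge> 1" and f: "real_or_infty n f" "DDM_convex n f"
    and step: "scaling_step n f s s'" and inv: "scaling_invariant n f m s"
  shows "remaining_work ((n + 1) * (m + 1)) s' < remaining_work ((n + 1) * (m + 1)) s"
  using step
proof cases
  case (descend x \<alpha> d d' c)
  have "scaling_invariant n f m (Phase x \<alpha> d' (Suc c))"
    using scaling_invariant_step[OF n f step inv] unfolding descend(2) .
  then have "Suc c \<le> (n + 1) * (m + 1)" by (rule scaling_invariant_calls_le)
  moreover obtain y where "d = Search y" using descend(3) by cases auto
  ultimately show ?thesis unfolding descend(1,2) by (cases d') (simp_all del: mult_Suc mult_Suc_right)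
qed auto

lemma scaling_terminates:
  assumes n: "n \<ge> 1" and f: "real_or_infty n f" "DDM_convex n f"
  shows "scaling_invariant n f m s \<Longrightarrow> termip (scaling_step n f) s"
proof (induction "remaining_work ((n + 1) * (m + 1)) s" arbitrary: s rule: less_induct)
  case less
  show ?case
  proof (rule accpI)
    fix s' assume "(scaling_step n f)\<inverse>\<inverse> s' s"
    then have st: "scaling_step n f s s'" by simp
    show "termip (scaling_step n f) s'"
      using less.hyps[OF remaining_work_decreases[OF n f st less.prems]]
        scaling_invariant_step[OF n f st less.prems] by blast
  qed
qed

lemma norm_inf_diff_le_K_inf:
  assumes n: "n \<ge> 1" and bd: "bounded_inf (edom n f)" and xy: "x \<in> edom n f" "y \<in> edom n f"
  shows "norm_inf (x - y) \<le> K_inf n f"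
proof -
  obtain B where B: "\<And>x. x \<in> edom n f \<Longrightarrow> norm_inf x \<le> B" using bd by (auto simp: bounded_inf_def)
  have "norm_inf (x - y) \<in> {0..2 * B}" if uv: "x \<in> edom n f" "y \<in> edom n f" for x y
  proof -
    have c: "x \<in> carrier_vec n" "y \<in> carrier_vec n" "x - y \<in> carrier_vec n"
      using uv by (auto simp: edom_def)
    have "\<bar>(x - y) $ i\<bar> \<le> 2 * B" if i: "i < n" for i
    proof -
      have "\<bar>x $ i\<bar> \<le> B" "\<bar>y $ i\<bar> \<le> B"
        using B[OF uv(1)] B[OF uv(2)] i norm_inf_le_iff[OF c(1) n] norm_inf_le_iff[OF c(2) n]
        by auto
      then show ?thesis using c i by simp
    qed
    then show ?thesis using norm_inf_le_iff[OF c(3) n] norm_inf_nonneg[OF c(3) n] by simp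
  qed
  then have "{norm_inf (x - y) | x y. x \<in> edom n f \<and> y \<in> edom n f} \<subseteq> {0..2 * B}" by blast
  then have "finite {norm_inf (x - y) | x y. x \<in> edom n f \<and> y \<in> edom n f}"
    using finite_subset by blast
  then show ?thesis unfolding K_inf_def using xy by (intro Max_ge) auto
qed

text \<open>
  A translate of \<open>x\<close> by a nonzero multiple of \<open>2\<^sup>m\<^sup>+\<^sup>1\<close> is farther away than the diameter of the
  effective domain, so \<open>f\<close> is infinite there.
\<close>

lemma scaling_invariant_init:
  assumes n: "n \<ge> 1" and bd: "bounded_inf (edom n f)" and x: "x \<in> edom n f"
    and m: "K_inf n f < 2 ^ m"
  shows "scaling_invariant n f m (Phase x (2 ^ m) (Search (0\<^sub>v n)) 0)"
proof -
  have xc: "x \<in> carrier_vec n" using x by (simp add: edom_def)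
  have "f x \<le> f (x + (2 * 2 ^ m) \<cdot>\<^sub>v z)" if z: "z \<in> carrier_vec n" for z
  proof (cases "f (x + (2 * 2 ^ m) \<cdot>\<^sub>v z) = \<infinity>")
    case False
    then have "x + (2 * 2 ^ m) \<cdot>\<^sub>v z \<in> edom n f" using xc z by (auto simp: edom_def)
    then have K: "norm_inf (x + (2 * 2 ^ m) \<cdot>\<^sub>v z - x) \<le> K_inf n f"
      using norm_inf_diff_le_K_inf[OF n bd _ x] by blast
    have "z $ i = 0" if i: "i < n" for i
    proof (rule ccontr)
      assume "z $ i \<noteq> 0"
      then have "(2 * 2 ^ m) * 1 \<le> (2 * 2 ^ m) * \<bar>z $ i\<bar>" by (intro mult_left_mono) auto
      also have "\<dots> = \<bar>(x + (2 * 2 ^ m) \<cdot>\<^sub>v z - x) $ i\<bar>" using i xc z by (simp add: abs_mult)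
      also have "\<dots> \<le> K_inf n f"
        using K norm_inf_le_iff[of "x + (2 * 2 ^ m) \<cdot>\<^sub>v z - x" n] n xc z i by auto
      also have "\<dots> < 2 ^ m" by (rule m)
      finally show False by simp
    qed
    then have "x + (2 * 2 ^ m) \<cdot>\<^sub>v z = x" by (intro eq_vecI) (use xc z in auto)
    then show ?thesis by simp
  qed simp
  moreover have "descent_invariant n (scaled_box n f x (2 ^ m)) (Search (0\<^sub>v n)) 0"
    by (rule descent_invariant_start[OF n])
      (use x xc n in \<open>simp add: scaled_box_def norm_inf_zero edom_def add_smult_zero_vec\<close>)
  ultimately show ?thesis using x unfolding scaling_invariant.simps by (intro exI[of _ m] exI[of _ 0]) auto
qed

lemma less_two_power_nat_ceiling_log:
  assumes "K \<ge> (0::int)"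
  shows "K < 2 ^ nat \<lceil>log 2 (real_of_int (K + 1))\<rceil>"
proof -
  let ?m = "nat \<lceil>log 2 (real_of_int (K + 1))\<rceil>"
  have "real_of_int (K + 1) = 2 powr log 2 (real_of_int (K + 1))" using assms by simp
  also have "\<dots> \<le> 2 powr real ?m" by (intro powr_mono real_nat_ceiling_ge) auto
  also have "\<dots> = real_of_int (2 ^ ?m)" by (simp add: powr_realpow)
  finally show ?thesis using of_int_le_iff[where ?'a = real] by (smt (verit))
qed

text \<open>
  For \<open>K \<ge> 2\<close> one has \<open>K + 1 \<le> K\<^sup>2\<close> and \<open>1 \<le> log\<^sub>2 K\<close>, so the number of phases is at most
  \<open>2 log\<^sub>2 K + 2 \<le> 4 log\<^sub>2 K\<close>; the remaining factor comes from \<open>n + 1 \<le> 2 n\<close>.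
\<close>

lemma scaling_call_bound:
  assumes K: "K \<ge> (2::int)" and n: "n \<ge> 1"
    and c: "c \<le> (n + 1) * (nat \<lceil>log 2 (real_of_int (K + 1))\<rceil> + 1)"
  shows "real c \<le> 8 * real n * log 2 (real_of_int K)"
proof -
  let ?L = "log 2 (real_of_int K)" and ?m = "nat \<lceil>log 2 (real_of_int (K + 1))\<rceil>"
  have L: "1 \<le> ?L" using K by (simp add: le_log_iff)
  have "2 * K \<le> K * K" using K by (intro mult_right_mono) auto
  then have "K + 1 \<le> K ^ 2" unfolding power2_eq_square using K by linarith
  then have "real_of_int (K + 1) \<le> real_of_int K ^ 2" by (metis of_int_le_iff of_int_power)
  then have "log 2 (real_of_int (K + 1)) \<le> log 2 (real_of_int K ^ 2)" using K by (intro log_mono) auto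
  also have "\<dots> = 2 * ?L" using K by (simp add: log_nat_power)
  finally have "log 2 (real_of_int (K + 1)) \<le> 2 * ?L" .
  moreover have "log 2 (real_of_int (K + 1)) \<ge> 0" using K by simp
  ultimately have "real ?m \<le> 2 * ?L + 1" by linarith
  then have m: "real ?m + 1 \<le> 4 * ?L" using L by linarith
  have "real c \<le> real ((n + 1) * (?m + 1))" using c by (rule of_nat_mono)
  also have "\<dots> = (real n + 1) * (real ?m + 1)" by (simp add: algebra_simps)
  also have "\<dots> \<le> (2 * real n) * (4 * ?L)" using m n by (intro mult_mono) auto
  finally show ?thesis by simp
qed

theorem theorem8p3:
  shows "\<exists>C::real. \<forall>(n::nat) (f :: int vec \<Rightarrow> ereal) (x0 :: int vec).
    n \<ge> 1 \<longrightarrow> real_or_infty n f \<longrightarrow> DDM_convex n f \<longrightarrow>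
    edom n f \<noteq> {} \<longrightarrow> bounded_inf (edom n f) \<longrightarrow> x0 \<in> edom n f \<longrightarrow>
      termip (scaling_step n f) (scaling_init n f x0) \<and>
      (\<forall>s. (scaling_step n f)\<^sup>*\<^sup>* (scaling_init n f x0) s \<longrightarrow>
           \<not> (\<exists>s'. scaling_step n f s s') \<longrightarrow>
           (\<exists>x c. s = Stopped x c \<and>
                  is_arg_min f (\<lambda>z. z \<in> carrier_vec n) x \<and>
                  (K_inf n f \<ge> 2 \<longrightarrow> real c \<le> C * real n * log 2 (real_of_int (K_inf n f)))))"
proof (intro exI[of _ 8] allI impI)
  fix n :: nat and f :: "int vec \<Rightarrow> ereal" and x0 :: "int vec"
  assume n: "n \<ge> 1" and f: "real_or_infty n f" "DDM_convex n f"
    and bd: "bounded_inf (edom n f)" and x0: "x0 \<in> edom n f"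
  define m where "m = nat \<lceil>log 2 (real_of_int (K_inf n f + 1))\<rceil>"
  have x0c: "x0 \<in> carrier_vec n" using x0 by (simp add: edom_def)
  have "norm_inf (x0 - x0) \<ge> 0" using norm_inf_nonneg[OF _ n] x0c by simp
  then have "K_inf n f \<ge> 0" using norm_inf_diff_le_K_inf[OF n bd x0 x0] by linarith
  then have "K_inf n f < 2 ^ m" unfolding m_def by (rule less_two_power_nat_ceiling_log)
  then have init: "scaling_invariant n f m (scaling_init n f x0)"
    unfolding scaling_init_def m_def[symmetric] by (rule scaling_invariant_init[OF n bd x0])
  show "termip (scaling_step n f) (scaling_init n f x0) \<and>
      (\<forall>s. (scaling_step n f)\<^sup>*\<^sup>* (scaling_init n f x0) s \<longrightarrow>
           \<not> (\<exists>s'. scaling_step n f s s') \<longrightarrow>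
           (\<exists>x c. s = Stopped x c \<and>
                  is_arg_min f (\<lambda>z. z \<in> carrier_vec n) x \<and>
                  (K_inf n f \<ge> 2 \<longrightarrow> real c \<le> 8 * real n * log 2 (real_of_int (K_inf n f)))))"
  proof (intro conjI allI impI)
    show "termip (scaling_step n f) (scaling_init n f x0)"
      by (rule scaling_terminates[OF n f init])
    fix s
    assume reach: "(scaling_step n f)\<^sup>*\<^sup>* (scaling_init n f x0) s"
      and final: "\<not> (\<exists>s'. scaling_step n f s s')"
    from reach have inv: "scaling_invariant n f m s"
      by (induction rule: rtranclp_induct) (use init scaling_invariant_step[OF n f] in blast)+
    show "\<exists>x c. s = Stopped x c \<and> is_arg_min f (\<lambda>z. z \<in> carrier_vec n) x \<and>
        (K_inf n f \<ge> 2 \<longrightarrow> real c \<le> 8 * real n * log 2 (real_of_int (K_inf n f)))"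
    proof (cases s)
      case (Phase x \<alpha> d c)
      then show ?thesis using scaling_step_exists[OF n] inv final by blast
    next
      case (Stopped x c)
      have "is_arg_min f (\<lambda>z. z \<in> carrier_vec n) x"
        using inv Stopped by (auto simp: is_arg_min_def not_less)
      moreover have "c \<le> (n + 1) * (m + 1)" using inv Stopped by simp
      ultimately show ?thesis using Stopped scaling_call_bound[OF _ n] unfolding m_def by blast
    qed
  qed
qed

end
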